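(* For each $\lambda\in[0,1]$ there exists an $(N)$-dense set $A\subset\mathbb N$ such that $\lim_{n\to\infty}\frac{\log A(n)}{\log n}=\lambda$ (in particular, $A$ has exponent of convergence equal to $\lambda$).
   Context: $\mathbb N$ is the set of positive integers, $\log$ is the natural logarithm, and $A(x)=\#\{a\in A:a\le x\}$. For $A,B\subset\mathbb N$ put $R(A,B)=\{\frac ab:a\in A,\ b\in B\}$; the set $A$ is called $(N)$-dense if $R(A,B)$ is dense in $(0,\infty)$ for every infinite $B\subset\mathbb N$. The exponent of convergence of $A\subset\mathbb N$ is $\lambda(A)=\inf\{t>0:\sum_{a\in A}a^{-t}<\infty\}$. *)

theory Defs
  imports "HOL-Analysis.Analysis"
begin

(* Sets of positive integers are sets A :: nat set with A \<subseteq> {1..}. *)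

definition ratio_set :: "nat set \<Rightarrow> nat set \<Rightarrow> real set" where
  "ratio_set A B = {real a / real b | a b. a \<in> A \<and> b \<in> B}"

(* For A, B \<subseteq> {1..} the ratio set lies in (0,\<infinity>), so being dense in (0,\<infinity>)
   means that its closure contains (0,\<infinity>). *)
definition N_dense :: "nat set \<Rightarrow> bool" where
  "N_dense A \<longleftrightarrow> (\<forall>B. B \<subseteq> {1..} \<and> infinite B \<longrightarrow> {0<..} \<subseteq> closure (ratio_set A B))"

definition counting :: "nat set \<Rightarrow> real \<Rightarrow> nat" where
  "counting A x = card {a \<in> A. real a \<le> x}"

(* For A \<subseteq> {1..} the infimum is over a set that contains 2 and is bounded below
   by 0, so Inf on the reals is the true infimum. *)
definition convergence_exponent :: "nat set \<Rightarrow> real" where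
  "convergence_exponent A = Inf {t. t > 0 \<and> (\<lambda>a. real a powr (- t)) summable_on A}"

end

theory Submission
  imports Defs "HOL-Real_Asymp.Real_Asymp"
begin

text \<open>
  If consecutive terms of a strictly increasing sequence \<open>a\<close> of positive integers have ratios
  tending to 1, then its range is (N)-dense: for \<open>y > 0\<close> and a large \<open>b\<close>, the number \<open>y * b\<close>
  lies between consecutive terms \<open>a k\<close> and \<open>a (k + 1)\<close>, which differ by a small fraction of
  \<open>y * b\<close>, so \<open>a k / b\<close> is close to \<open>y\<close>. Every sufficiently large \<open>b\<close> works, hence some member
  of any infinite set \<open>B\<close> does (\<open>N_dense_range\<close>).

  The ratio condition forces growth slower than geometric and otherwise leaves the rate free.
  The counting function inverts \<open>a\<close>, so its logarithmic growth rate is the limit of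
  \<open>ln n / ln (a n)\<close> (\<open>ln_counting_range_tendsto\<close>), and comparing the series of \<open>a n powr -t\<close>
  with p-series shows that this limit is the exponent of convergence as well
  (\<open>convergence_exponent_range\<close>).

  Rounding down \<open>(n + 3) powr (1 / l)\<close> gives the limit \<open>l\<close> for \<open>0 < l \<le> 1\<close>. For \<open>l = 0\<close> the
  growth must be faster than every power but still slower than geometric; replacing the exponent
  by the slowly increasing \<open>ln (n + 3)\<close> achieves this.
\<close>

section \<open>Ranges of increasing integer sequences\<close>

lemma strict_mono_gt_index:
  fixes a :: "nat \<Rightarrow> nat"
  assumes "strict_mono a" and "a 0 \<ge> 1"
  shows "a n > n"
proof (induction n)
  case (Suc n)
  have "a n < a (Suc n)" using assms(1) by (simp add: strict_mono_Suc_iff)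
  with Suc show ?case by simp
qed (use assms(2) in simp)

text \<open>
  The counting function is a generalised inverse of the sequence. Indices start at 0, so when
  \<open>x\<close> is at least \<open>a 0\<close> and the counting function takes the value \<open>K\<close> at \<open>x\<close>, this equivalence
  places \<open>x\<close> in the half-open interval from \<open>a (K - 1)\<close> to \<open>a K\<close>.
\<close>
lemma counting_range_bracket:
  fixes a :: "nat \<Rightarrow> nat"
  assumes "strict_mono a"
  shows "real (a i) \<le> x \<longleftrightarrow> i < counting (range a) x"
proof -
  obtain j where "x < real j" using reals_Archimedean2 by blast
  also have "real j \<le> real (a j)"
    using strict_mono_imp_increasing[OF assms] by simp
  finally have ex: "x < real (a j)" .
  define m where "m = (LEAST i. x < real (a i))"
  have m: "x < real (a m)"
    unfolding m_def using ex by (rule LeastI)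
  have eq: "real (a i) \<le> x \<longleftrightarrow> i < m" for i
  proof
    assume "real (a i) \<le> x"
    with m have "a i < a m" by linarith
    then show "i < m" using assms by (simp add: strict_mono_less)
  next
    assume "i < m"
    then show "real (a i) \<le> x"
      unfolding m_def using not_less_Least not_less by blast
  qed
  have "{b \<in> range a. real b \<le> x} = a ` {..<m}"
    using eq by auto
  then have "counting (range a) x = m"
    unfolding counting_def
    using assms by (simp add: card_image strict_mono_imp_inj_on)
  then show ?thesis using eq by simp
qed

lemma N_dense_range:
  fixes a :: "nat \<Rightarrow> nat"
  assumes mono: "strict_mono a" and pos: "a 0 \<ge> 1"
    and ratio: "(\<lambda>n. real (a (Suc n)) / real (a n)) \<longlonglongrightarrow> 1"
  shows "N_dense (range a)"
  unfolding N_dense_def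
proof (intro allI impI subsetI)
  fix B :: "nat set" and y :: real
  assume B: "B \<subseteq> {1..} \<and> infinite B" and "y \<in> {0<..}"
  then have y: "y > 0" by simp
  have apos: "a n \<ge> 1" for n
    using strict_mono_gt_index[OF mono pos, of n] by simp
  show "y \<in> closure (ratio_set (range a) B)"
    unfolding closure_approachable
  proof (intro allI impI)
    fix e :: real assume e: "e > 0"
    \<comment> \<open>The gap above \<open>a k\<close> must be below \<open>e * b\<close>, and \<open>a k\<close> can be as large as \<open>y * b\<close>;
      hence the relative gap allowed is \<open>e / y\<close>.\<close>
    then have "1 < 1 + e / y" using y by simp
    with ratio have "\<forall>\<^sub>F n in sequentially. real (a (Suc n)) / real (a n) < 1 + e / y"
      by (rule order_tendstoD)
    then obtain N where N: "\<And>n. n \<ge> N \<Longrightarrow> real (a (Suc n)) / real (a n) < 1 + e / y"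
      by (auto simp: eventually_sequentially)
    \<comment> \<open>Large enough for the bracketing index \<open>k\<close> of \<open>y * b\<close> below to be at least \<open>N\<close>.\<close>
    obtain b where b: "b \<in> B" "b > nat \<lceil>real (a N) / y\<rceil>"
      using B by (meson infinite_nat_iff_unbounded)
    then have "real (a N) / y \<le> real b" by linarith
    then have aN: "real (a N) \<le> y * real b" using y by (simp add: field_simps)
    have b0: "real b > 0" using b by simp
    define k where "k = counting (range a) (y * real b) - 1"
    have "N < counting (range a) (y * real b)"
      using aN counting_range_bracket[OF mono] by simp
    then have k: "k \<ge> N" "real (a k) \<le> y * real b" "y * real b < real (a (Suc k))"
      using counting_range_bracket[OF mono, of k "y * real b"]
        counting_range_bracket[OF mono, of "Suc k" "y * real b"]
      by (auto simp: k_def)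
    have "real (a (Suc k)) < (1 + e / y) * real (a k)"
      using N[OF k(1)] apos[of k] by (simp add: field_simps)
    also have "\<dots> = real (a k) + e / y * real (a k)"
      by (simp add: algebra_simps)
    also have "\<dots> \<le> real (a k) + e / y * (y * real b)"
      using k(2) e y by (intro add_left_mono mult_left_mono) auto
    also have "\<dots> = real (a k) + e * real b"
      using y by simp
    finally have "y * real b < real (a k) + e * real b"
      using k(3) by linarith
    then have "y < real (a k) / real b + e"
      using b0 by (simp add: field_simps)
    moreover have "real (a k) / real b \<le> y"
      using k(2) b0 by (simp add: field_simps)
    ultimately have "dist (real (a k) / real b) y < e"
      unfolding dist_real_def by linarith
    moreover have "real (a k) / real b \<in> ratio_set (range a) B"
      using b unfolding ratio_set_def by auto
    ultimately show "\<exists>z\<in>ratio_set (range a) B. dist z y < e" by blast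
  qed
qed

text \<open>
  With \<open>K\<close> the value of the counting function at \<open>n\<close>, the bracketing of \<open>n\<close> by \<open>a (K - 1)\<close>
  and \<open>a K\<close> squeezes the quotient between \<open>ln K / ln (a K)\<close> and \<open>ln K / ln (a (K - 1))\<close>. The two
  have the same limit because the ratio condition makes \<open>ln (a K) - ln (a (K - 1))\<close> tend to 0
  while \<open>ln (a K)\<close> tends to infinity.
\<close>
lemma ln_counting_range_tendsto:
  fixes a :: "nat \<Rightarrow> nat"
  assumes mono: "strict_mono a" and pos: "a 0 \<ge> 1"
    and ratio: "(\<lambda>n. real (a (Suc n)) / real (a n)) \<longlonglongrightarrow> 1"
    and growth: "(\<lambda>n. ln (real n) / ln (real (a n))) \<longlonglongrightarrow> l"
  shows "(\<lambda>n::nat. ln (real (counting (range a) (real n))) / ln (real n)) \<longlonglongrightarrow> l"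
proof -
  let ?K = "\<lambda>n::nat. counting (range a) (real n)"
  have apos: "a n \<ge> 1" and agt: "n > 0 \<Longrightarrow> a n > 1" for n
    using strict_mono_gt_index[OF mono pos, of n] by auto
  have "filterlim (\<lambda>n. real (a n)) at_top sequentially"
    using filterlim_subseq[OF mono] filterlim_real_sequentially filterlim_compose by blast
  then have lninf: "filterlim (\<lambda>n. ln (real (a n))) at_top sequentially"
    using ln_at_top filterlim_compose by blast
  have "(\<lambda>n. ln (real (a (Suc n)) / real (a n))) \<longlonglongrightarrow> ln 1"
    using ratio by (rule tendsto_ln) simp
  then have "(\<lambda>n. ln (real (a (Suc n)) / real (a n)) / ln (real (a n))) \<longlonglongrightarrow> 0"
    using lninf by (intro real_tendsto_divide_at_top[where c = "ln 1"])
  then have "(\<lambda>n. 1 + ln (real (a (Suc n)) / real (a n)) / ln (real (a n))) \<longlonglongrightarrow> 1 + 0"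
    by (intro tendsto_add tendsto_const)
  then have "(\<lambda>n. ln (real (Suc n)) / ln (real (a (Suc n)))
      * (1 + ln (real (a (Suc n)) / real (a n)) / ln (real (a n)))) \<longlonglongrightarrow> l * (1 + 0)"
    by (intro tendsto_mult LIMSEQ_Suc[OF growth])
  moreover have "\<forall>\<^sub>F n in sequentially. ln (real (Suc n)) / ln (real (a (Suc n)))
      * (1 + ln (real (a (Suc n)) / real (a n)) / ln (real (a n)))
      = ln (real (Suc n)) / ln (real (a n))"
    using eventually_gt_at_top[of 0]
  proof eventually_elim
    case (elim n)
    have "ln (real (a n)) > 0" "ln (real (a (Suc n))) > 0"
      using agt[of n] agt[of "Suc n"] elim by auto
    moreover have "ln (real (a (Suc n)) / real (a n)) = ln (real (a (Suc n))) - ln (real (a n))"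
      using apos[of n] apos[of "Suc n"] by (intro ln_divide_pos) auto
    ultimately show ?case by (simp add: field_simps)
  qed
  ultimately have "(\<lambda>n. ln (real (Suc n)) / ln (real (a n))) \<longlonglongrightarrow> l * (1 + 0)"
    by (rule Lim_transform_eventually)
  then have "(\<lambda>n. ln (real (Suc n)) / ln (real (a n))) \<longlonglongrightarrow> l" by simp
  \<comment> \<open>Shift the index so that the counting function itself can be substituted for it.\<close>
  then have "(\<lambda>n. ln (real (Suc (n - 1))) / ln (real (a (n - 1)))) \<longlonglongrightarrow> l"
    by (subst filterlim_sequentially_Suc[symmetric]) simp
  moreover have Kinf: "filterlim ?K at_top sequentially"
    unfolding filterlim_at_top eventually_sequentially
  proof (intro allI exI impI)
    fix k n assume "a k \<le> n"
    then show "k \<le> ?K n"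
      using counting_range_bracket[OF mono, of k "real n"] by simp
  qed
  ultimately have upper:
    "(\<lambda>n. ln (real (Suc (?K n - 1))) / ln (real (a (?K n - 1)))) \<longlonglongrightarrow> l"
    by (rule filterlim_compose)
  have lower: "(\<lambda>n. ln (real (?K n)) / ln (real (a (?K n)))) \<longlonglongrightarrow> l"
    using growth Kinf by (rule filterlim_compose)
  have bounds: "\<forall>\<^sub>F n in sequentially.
      ln (real (?K n)) / ln (real (a (?K n))) \<le> ln (real (?K n)) / ln (real n) \<and>
      ln (real (?K n)) / ln (real n) \<le> ln (real (Suc (?K n - 1))) / ln (real (a (?K n - 1)))"
    using eventually_ge_at_top[of "a 1"]
  proof eventually_elim
    case (elim n)
    then have K: "1 < ?K n"
      using counting_range_bracket[OF mono, of 1 "real n"] by simp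
    have le: "real (a (?K n - 1)) \<le> real n"
      using counting_range_bracket[OF mono, of "?K n - 1" "real n"] K by linarith
    have ge: "real n < real (a (?K n))"
      using counting_range_bracket[OF mono, of "?K n" "real n"] by linarith
    have gt: "1 < real (a (?K n - 1))"
      using agt[of "?K n - 1"] K by simp
    show ?case
      using K le ge gt by (auto intro!: divide_left_mono mult_pos_pos)
  qed
  show ?thesis
    by (rule tendsto_sandwich[OF _ _ lower upper])
       (use bounds in \<open>auto elim: eventually_mono\<close>)
qed

text \<open>
  The growth condition compares \<open>a n\<close> with powers of \<open>n\<close>. For \<open>l < s < t\<close> the terms \<open>a n powr -t\<close> are eventually at
  most \<open>n powr -(t / s)\<close>, and \<open>t / s > 1\<close>; for \<open>0 < t < l\<close> they are eventually at least \<open>1 / n\<close>.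
  Working with an intermediate \<open>s\<close> instead of \<open>l\<close> also covers \<open>l = 0\<close>. The behaviour at
  \<open>t = l\<close> does not affect the infimum.
\<close>
lemma convergence_exponent_range:
  fixes a :: "nat \<Rightarrow> nat"
  assumes mono: "strict_mono a" and pos: "a 0 \<ge> 1" and "l \<ge> 0"
    and growth: "(\<lambda>n. ln (real n) / ln (real (a n))) \<longlonglongrightarrow> l"
  shows "convergence_exponent (range a) = l"
proof -
  have apos: "a n \<ge> 1" and agt: "n > 0 \<Longrightarrow> a n > 1" for n
    using strict_mono_gt_index[OF mono pos, of n] by auto
  have series: "(\<lambda>b. real b powr (- t)) summable_on range a
      \<longleftrightarrow> summable (\<lambda>n. real (a n) powr (- t))" for t
    using summable_on_reindex[OF strict_mono_imp_inj_on[OF mono], of "\<lambda>b. real b powr (- t)"]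
    by (simp add: o_def summable_on_UNIV_nonneg_real_iff)
  let ?S = "{t. t > 0 \<and> summable (\<lambda>n. real (a n) powr (- t))}"
  have conv: "t \<in> ?S" if "l < t" for t
  proof -
    obtain s where s: "l < s" "s < t" using dense[OF \<open>l < t\<close>] by blast
    have "\<forall>\<^sub>F n in sequentially. ln (real n) / ln (real (a n)) < s"
      using growth s(1) by (rule order_tendstoD)
    then have "\<forall>\<^sub>F n in sequentially. norm (real (a n) powr (- t)) \<le> real n powr (- (t / s))"
      using eventually_gt_at_top[of 0]
    proof eventually_elim
      case (elim n)
      have "ln (real (a n)) > 0" using agt[of n] elim by simp
      then have "ln (real n) < s * ln (real (a n))"
        using elim by (simp add: field_simps)
      then have "t / s * ln (real n) \<le> t / s * (s * ln (real (a n)))"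
        using s \<open>l \<ge> 0\<close> by (intro mult_left_mono) auto
      then have "t / s * ln (real n) \<le> t * ln (real (a n))"
        using s \<open>l \<ge> 0\<close> by simp
      then show ?case using apos[of n] elim by (simp add: powr_def)
    qed
    moreover have "summable (\<lambda>n. real n powr (- (t / s)))"
      using s \<open>l \<ge> 0\<close> by (subst summable_real_powr_iff) (simp add: field_simps)
    ultimately have "summable (\<lambda>n. real (a n) powr (- t))"
      by (rule summable_comparison_test_ev)
    then show ?thesis using that \<open>l \<ge> 0\<close> by simp
  qed
  have div: "l \<le> t" if "t \<in> ?S" for t
  proof (rule ccontr)
    assume "\<not> l \<le> t"
    then have "t < l" by simp
    with growth have "\<forall>\<^sub>F n in sequentially. t < ln (real n) / ln (real (a n))"
      by (rule order_tendstoD)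
    then have "\<forall>\<^sub>F n in sequentially. norm (real n powr (- 1)) \<le> real (a n) powr (- t)"
      using eventually_gt_at_top[of 0]
    proof eventually_elim
      case (elim n)
      have "ln (real (a n)) > 0" using agt[of n] elim by simp
      then have "t * ln (real (a n)) < ln (real n)"
        using elim by (simp add: field_simps)
      then show ?case using apos[of n] elim by (simp add: powr_def)
    qed
    then have "summable (\<lambda>n. real n powr (- 1))"
      by (rule summable_comparison_test_ev) (use that in simp)
    then show False by (subst (asm) summable_real_powr_iff) simp
  qed
  have "Inf ?S = l"
  proof (rule antisym)
    show "l \<le> Inf ?S"
      using conv[of "l + 1"] div by (intro cInf_greatest) auto
    show "Inf ?S \<le> l"
    proof (rule dense_ge)
      fix t assume "l < t"
      have "bdd_below ?S" using div by (rule bdd_belowI)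
      with conv[OF \<open>l < t\<close>] show "Inf ?S \<le> t" by (rule cInf_lower)
    qed
  qed
  then show ?thesis unfolding convergence_exponent_def series .
qed

section \<open>Sequences of prescribed growth\<close>

text \<open>
  Gaps of length at least 1 keep the integer parts of successive terms distinct. Allowing the
  exponent to increase from \<open>c\<close> to \<open>d\<close> covers the sequence with exponent \<open>ln (n + 3)\<close>.
\<close>
lemma powr_succ_ge:
  fixes x c d :: real
  assumes "x \<ge> 1" "1 \<le> c" "c \<le> d"
  shows "(x + 1) powr d \<ge> x powr c + 1"
proof -
  have "x powr c + 1 \<le> x powr (c - 1) * x + x powr (c - 1)"
    using assms ge_one_powr_ge_zero[of x "c - 1"] by (simp add: powr_diff)
  also have "\<dots> = x powr (c - 1) * (x + 1)" by (simp add: algebra_simps)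
  also have "\<dots> \<le> (x + 1) powr (c - 1) * (x + 1)"
    using assms by (intro mult_right_mono powr_mono2) auto
  also have "\<dots> = (x + 1) powr c"
    using assms by (simp add: powr_diff)
  also have "\<dots> \<le> (x + 1) powr d"
    using assms by (intro powr_mono) auto
  finally show ?thesis .
qed

text \<open>
  The shift by 3 makes the exponent \<open>ln (n + 3)\<close> at least 1 from the start, since \<open>exp 1 \<le> 3\<close>,
  so that the gap estimate applies at every index.
\<close>
lemma ex_real_seq_with_growth:
  assumes "0 \<le> l" and "l \<le> 1"
  obtains f :: "nat \<Rightarrow> real" where "f 0 \<ge> 1" "\<And>n. f (Suc n) \<ge> f n + 1"
    "(\<lambda>n. f (Suc n) / f n) \<longlonglongrightarrow> 1" "(\<lambda>n. ln (real n) / ln (f n)) \<longlonglongrightarrow> l"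
proof (cases "l = 0")
  case True
  define f where "f = (\<lambda>n. (real n + 3) powr ln (real n + 3))"
  have ln3: "ln (real n + 3) \<ge> 1" for n
  proof -
    have "exp 1 \<le> real n + 3" using exp_le by linarith
    then show ?thesis by (subst ln_ge_iff) auto
  qed
  show ?thesis
  proof (rule that[of f])
    show "f 0 \<ge> 1" using ln3[of 0] by (simp add: f_def ge_one_powr_ge_zero)
    show "f (Suc n) \<ge> f n + 1" for n
      using powr_succ_ge[of "real n + 3" "ln (real n + 3)" "ln (real (Suc n) + 3)"] ln3[of n]
      by (simp add: f_def add_ac)
    show "(\<lambda>n. f (Suc n) / f n) \<longlonglongrightarrow> 1"
      unfolding f_def by real_asymp
    show "(\<lambda>n. ln (real n) / ln (f n)) \<longlonglongrightarrow> l"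
      unfolding f_def True by real_asymp
  qed
next
  case False
  define c where "c = 1 / l"
  have c: "c \<ge> 1" "l = 1 / c" using assms False by (auto simp: c_def)
  then have c0: "c > 0" by simp
  define f where "f = (\<lambda>n. (real n + 3) powr c)"
  show ?thesis
  proof (rule that[of f])
    show "f 0 \<ge> 1" using c by (simp add: f_def ge_one_powr_ge_zero)
    show "f (Suc n) \<ge> f n + 1" for n
      using powr_succ_ge[of "real n + 3" c c] c by (simp add: f_def add_ac)
    show "(\<lambda>n. f (Suc n) / f n) \<longlonglongrightarrow> 1"
      unfolding f_def using c0 by real_asymp
    show "(\<lambda>n. ln (real n) / ln (f n)) \<longlonglongrightarrow> l"
      unfolding f_def c(2) using c0 by real_asymp (simp add: field_simps)
  qed
qed

text \<open>
  Rounding down preserves both limits, since the real sequence tends to infinity and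
  \<open>\<lfloor>x\<rfloor> / x\<close> and \<open>ln x / ln \<lfloor>x\<rfloor>\<close> tend to 1 as \<open>x\<close> tends to infinity.
\<close>
lemma ex_nat_seq_with_growth:
  assumes "0 \<le> l" and "l \<le> 1"
  obtains a :: "nat \<Rightarrow> nat" where "strict_mono a" "a 0 \<ge> 1"
    "(\<lambda>n. real (a (Suc n)) / real (a n)) \<longlonglongrightarrow> 1"
    "(\<lambda>n. ln (real n) / ln (real (a n))) \<longlonglongrightarrow> l"
proof -
  obtain f :: "nat \<Rightarrow> real" where f: "f 0 \<ge> 1" "\<And>n. f (Suc n) \<ge> f n + 1"
    "(\<lambda>n. f (Suc n) / f n) \<longlonglongrightarrow> 1" "(\<lambda>n. ln (real n) / ln (f n)) \<longlonglongrightarrow> l"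
    using ex_real_seq_with_growth[OF assms] by blast
  have f_ge: "f n \<ge> real n + 1" for n
  proof (induction n)
    case (Suc n)
    then show ?case using f(2)[of n] by simp
  qed (use f(1) in simp)
  have finf: "filterlim f at_top sequentially"
    by (rule filterlim_at_top_mono[where f = "\<lambda>n. real n + 1"])
       (real_asymp, use f_ge in simp)
  define a where "a = (\<lambda>n. nat \<lfloor>f n\<rfloor>)"
  have a: "real (a n) = real_of_int \<lfloor>f n\<rfloor>" for n
    using f_ge[of n] by (simp add: a_def)
  have apos: "a n \<ge> 1" for n
    using f_ge[of n] unfolding a_def by linarith
  have fl: "(\<lambda>n. real (a n) / f n) \<longlonglongrightarrow> 1"
  proof -
    have "((\<lambda>x::real. real_of_int \<lfloor>x\<rfloor> / x) \<longlongrightarrow> 1) at_top" by real_asymp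
    then show ?thesis unfolding a using finf by (rule filterlim_compose)
  qed
  have lnfl: "(\<lambda>n. ln (f n) / ln (real (a n))) \<longlonglongrightarrow> 1"
  proof -
    have "((\<lambda>x::real. ln x / ln (real_of_int \<lfloor>x\<rfloor>)) \<longlongrightarrow> 1) at_top" by real_asymp
    then show ?thesis unfolding a using finf by (rule filterlim_compose)
  qed
  show ?thesis
  proof (rule that[of a])
    show "strict_mono a"
      unfolding strict_mono_Suc_iff
    proof
      fix n
      show "a n < a (Suc n)"
        using f(2)[of n] f_ge[of n] unfolding a_def by linarith
    qed
    show "a 0 \<ge> 1" by (rule apos)
    have "(\<lambda>n. (real (a (Suc n)) / f (Suc n)) * (f (Suc n) / f n) / (real (a n) / f n))
        \<longlonglongrightarrow> 1 * 1 / 1"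
      by (intro tendsto_divide tendsto_mult LIMSEQ_Suc[OF fl] fl f(3)) simp
    moreover have "(real (a (Suc n)) / f (Suc n)) * (f (Suc n) / f n) / (real (a n) / f n)
        = real (a (Suc n)) / real (a n)" for n
      using f_ge[of n] f_ge[of "Suc n"] by (simp add: field_simps)
    ultimately show "(\<lambda>n. real (a (Suc n)) / real (a n)) \<longlonglongrightarrow> 1"
      by (simp only: mult_1 div_by_1)
    have "(\<lambda>n. ln (real n) / ln (f n) * (ln (f n) / ln (real (a n)))) \<longlonglongrightarrow> l * 1"
      by (intro tendsto_mult f(4) lnfl)
    moreover have "\<forall>\<^sub>F n in sequentially.
        ln (real n) / ln (f n) * (ln (f n) / ln (real (a n))) = ln (real n) / ln (real (a n))"
      using eventually_gt_at_top[of 0]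
    proof eventually_elim
      case (elim n)
      then have "ln (f n) > 0" using f_ge[of n] by (intro ln_gt_zero) simp
      then show ?case by simp
    qed
    ultimately have "(\<lambda>n. ln (real n) / ln (real (a n))) \<longlonglongrightarrow> l * 1"
      by (rule Lim_transform_eventually)
    then show "(\<lambda>n. ln (real n) / ln (real (a n))) \<longlonglongrightarrow> l" by simp
  qed
qed

theorem theorem7:
  fixes lam :: real
  assumes "0 \<le> lam" and "lam \<le> 1"
  shows "\<exists>A :: nat set. A \<subseteq> {1..} \<and> N_dense A \<and>
    (\<lambda>n::nat. ln (real (counting A (real n))) / ln (real n)) \<longlonglongrightarrow> lam \<and>
    convergence_exponent A = lam"
proof -
  obtain a :: "nat \<Rightarrow> nat" where a: "strict_mono a" "a 0 \<ge> 1"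
    "(\<lambda>n. real (a (Suc n)) / real (a n)) \<longlonglongrightarrow> 1"
    "(\<lambda>n. ln (real n) / ln (real (a n))) \<longlonglongrightarrow> lam"
    using ex_nat_seq_with_growth[OF assms] by blast
  have "a n \<ge> 1" for n
    using strict_mono_gt_index[OF a(1,2), of n] by simp
  then have "range a \<subseteq> {1..}" by auto
  with N_dense_range[OF a(1,2,3)] ln_counting_range_tendsto[OF a]
    convergence_exponent_range[OF a(1,2) assms(1) a(4)]
  show ?thesis by blast
qed

end
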